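(* Let $U\subset\mathbb{C}^n$ be a $0$-uniformly pseudoconvex domain, and let $F$ be a biholomorphism from an open set $W\subset\mathbb{C}^n$ with $W\supset\overline U$ onto an open subset of $\mathbb{C}^n$. Then $F(U)$ is $0$-uniformly pseudoconvex.
   Context: $bU$ denotes the boundary of $U$. Uniformly plurisubharmonic on average: for $V\subset\mathbb{C}^n$ open and $L>0$, an upper semicontinuous $g:V\to[-\infty,\infty)$ is $L$-uniformly plurisubharmonic on average if there is a lower semicontinuous $\delta:V\to(0,\infty)$ such that for all $a\in V$ and $b\in\mathbb{C}^n$ with $\|b\|<\delta(a)$ (where $\delta(a)$ is small enough that the closed disk $a+\overline{\mathbb{D}}b$ lies in $V$), $$L\|b\|^2+g(a)\le\frac1{2\pi}\int_0^{2\pi}g(a+e^{i\theta}b)\,d\theta.$$ $0$-uniformly pseudoconvex: a relatively compact domain $U\Subset\mathbb{C}^n$ is $0$-uniformly pseudoconvex if there exist positive constants $L,M,M'$, bounded neighborhoods $V_1,V_2$ of $bU$ with $V_2\supset\overline{V_1}$, and a function $r:V_2\to\mathbb{R}$ such that $U\cap V_2=\{z\in V_2:r(z)<0\}$ and $r$ is the (pointwise) limit on $V_2$ of a sequence $\{r_m\}$ of pointwise bounded $C^1$ functions $r_m:V_2\to\mathbb{R}$ such that each $r_m$ is $L$-uniformly plurisubharmonic on average on $V_2$ and $M'\ge\|\nabla r_m(z)\|\ge M$ for all $z\in\overline{V_1}$ and all $m$. *)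

theory Defs
  imports "HOL-Analysis.Analysis"
begin

definition usc_on :: "'a::topological_space set \<Rightarrow> ('a \<Rightarrow> 'b::linorder) \<Rightarrow> bool" where
  "usc_on V g \<longleftrightarrow> (\<forall>c. openin (top_of_set V) {x \<in> V. g x < c})"

definition lsc_on :: "'a::topological_space set \<Rightarrow> ('a \<Rightarrow> 'b::linorder) \<Rightarrow> bool" where
  "lsc_on V g \<longleftrightarrow> (\<forall>c. openin (top_of_set V) {x \<in> V. c < g x})"

text \<open>
  The mean of an extended-real function over the circle of parameters
  \<open>\<theta> \<in> [0, 2\<pi>]\<close>, as (integral of the positive part) minus (integral of the negative part);
  \<open>e2ennreal\<close> truncates negative arguments to 0. For an upper semicontinuous function without the
  value \<open>\<infinity>\<close> along the circle the positive part has finite integral, so the difference is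
  never \<open>\<infinity> - \<infinity>\<close>, but it may be \<open>-\<infinity>\<close>.
\<close>

definition circle_mean :: "(real \<Rightarrow> ereal) \<Rightarrow> ereal" where
  "circle_mean u = ereal (1 / (2 * pi)) *
     (enn2ereal (\<integral>\<^sup>+\<theta>\<in>{0..2 * pi}. e2ennreal (u \<theta>) \<partial>lborel) -
      enn2ereal (\<integral>\<^sup>+\<theta>\<in>{0..2 * pi}. e2ennreal (- u \<theta>) \<partial>lborel))"

lemma circle_mean_ereal:
  assumes "continuous_on {0..2 * pi} f"
  shows "circle_mean (\<lambda>\<theta>. ereal (f \<theta>)) = ereal (1 / (2 * pi) * integral {0..2 * pi} f)"
proof -
  let ?I = "{0..2 * pi}"
  have part: "enn2ereal (\<integral>\<^sup>+\<theta>\<in>?I. ennreal (g \<theta>) \<partial>lborel) = ereal (integral ?I (\<lambda>\<theta>. max 0 (g \<theta>)))"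
    if g: "continuous_on ?I g" for g
  proof -
    have c: "continuous_on ?I (\<lambda>\<theta>. max 0 (g \<theta>))"
      by (intro continuous_intros g)
    have "(\<integral>\<^sup>+\<theta>\<in>?I. ennreal (g \<theta>) \<partial>lborel) = (\<integral>\<^sup>+\<theta>. ennreal (indicator ?I \<theta> * max 0 (g \<theta>)) \<partial>lborel)"
      by (intro nn_integral_cong) (auto simp: indicator_def max_def ennreal_neg)
    also have "\<dots> = ennreal (LINT \<theta>|lborel. indicator ?I \<theta> * max 0 (g \<theta>))"
      using borel_integrable_atLeastAtMost'[OF c]
      by (intro nn_integral_eq_integral) (auto simp: set_integrable_def)
    also have "(LINT \<theta>|lborel. indicator ?I \<theta> * max 0 (g \<theta>)) = integral ?I (\<lambda>\<theta>. max 0 (g \<theta>))"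
      using set_borel_integral_eq_integral(2)[OF borel_integrable_atLeastAtMost'[OF c]]
      by (simp add: set_lebesgue_integral_def)
    finally show ?thesis
      by (simp add: integral_nonneg integrable_continuous_real c)
  qed
  have eq: "integral ?I f = integral ?I (\<lambda>\<theta>. max 0 (f \<theta>)) - integral ?I (\<lambda>\<theta>. max 0 (- f \<theta>))"
    by (subst integral_diff[symmetric])
       (auto intro!: integrable_continuous_real continuous_intros assms integral_cong)
  show ?thesis
    unfolding circle_mean_def
    using part[OF assms] part[of "\<lambda>\<theta>. - f \<theta>"] assms
    by (simp add: e2ennreal_ereal eq continuous_on_minus)
qed

definition uniformly_psh_on_average ::
    "real \<Rightarrow> (complex ^ 'n) set \<Rightarrow> (complex ^ 'n \<Rightarrow> ereal) \<Rightarrow> bool" where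
  "uniformly_psh_on_average L V g \<longleftrightarrow>
     L > 0 \<and> open V \<and> usc_on V g \<and> (\<forall>z\<in>V. g z \<noteq> \<infinity>) \<and>
     (\<exists>\<delta> :: complex ^ 'n \<Rightarrow> real. lsc_on V \<delta> \<and> (\<forall>z\<in>V. \<delta> z > 0) \<and>
       (\<forall>a\<in>V. \<forall>b. norm b < \<delta> a \<longrightarrow>
          (\<forall>\<zeta>\<in>cball 0 1. a + \<zeta> *s b \<in> V) \<and>
          ereal (L * (norm b)\<^sup>2) + g a \<le> circle_mean (\<lambda>\<theta>. g (a + exp (\<i> * complex_of_real \<theta>) *s b))))"

text \<open>
  \<open>C1_with_gradient V f G\<close>: on \<open>V\<close>, the function \<open>f\<close> is continuously differentiable with gradient
  \<open>G\<close>. For \<open>'a = complex ^ 'n\<close> the inner product is the one of the underlying real space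
  \<open>\<real>\<^sup>2\<^sup>n\<close>, so \<open>G\<close> is the real gradient.
\<close>

definition C1_with_gradient :: "'a::real_inner set \<Rightarrow> ('a \<Rightarrow> real) \<Rightarrow> ('a \<Rightarrow> 'a) \<Rightarrow> bool" where
  "C1_with_gradient V f G \<longleftrightarrow> (\<forall>z\<in>V. GDERIV f z :> G z) \<and> continuous_on V G"

definition zero_uniformly_pseudoconvex :: "(complex ^ 'n) set \<Rightarrow> bool" where
  "zero_uniformly_pseudoconvex U \<longleftrightarrow>
     open U \<and> connected U \<and> U \<noteq> {} \<and> compact (closure U) \<and>
     (\<exists>L M M' :: real. L > 0 \<and> M > 0 \<and> M' > 0 \<and>
      (\<exists>V\<^sub>1 V\<^sub>2. open V\<^sub>1 \<and> bounded V\<^sub>1 \<and> frontier U \<subseteq> V\<^sub>1 \<and>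
               open V\<^sub>2 \<and> bounded V\<^sub>2 \<and> frontier U \<subseteq> V\<^sub>2 \<and> closure V\<^sub>1 \<subseteq> V\<^sub>2 \<and>
       (\<exists>r :: complex ^ 'n \<Rightarrow> real. U \<inter> V\<^sub>2 = {z \<in> V\<^sub>2. r z < 0} \<and>
        (\<exists>(R :: nat \<Rightarrow> complex ^ 'n \<Rightarrow> real) G.
           (\<forall>z\<in>V\<^sub>2. bounded (range (\<lambda>m. R m z))) \<and>
           (\<forall>z\<in>V\<^sub>2. (\<lambda>m. R m z) \<longlonglongrightarrow> r z) \<and>
           (\<forall>m. C1_with_gradient V\<^sub>2 (R m) (G m)) \<and>
           (\<forall>m. uniformly_psh_on_average L V\<^sub>2 (\<lambda>z. ereal (R m z))) \<and>
           (\<forall>m. \<forall>z\<in>closure V\<^sub>1. M \<le> norm (G m z) \<and> norm (G m z) \<le> M')))))"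

text \<open>
  Holomorphy of a map between complex coordinate spaces: the real Frechet derivative exists and is
  complex linear.
\<close>

definition holomorphic_map_on :: "(complex ^ 'n \<Rightarrow> complex ^ 'm) \<Rightarrow> (complex ^ 'n) set \<Rightarrow> bool" where
  "holomorphic_map_on F W \<longleftrightarrow>
     (\<forall>z\<in>W. \<exists>T. (F has_derivative T) (at z) \<and> Vector_Spaces.linear (*s) (*s) T)"

definition biholomorphic_map ::
    "(complex ^ 'n \<Rightarrow> complex ^ 'm) \<Rightarrow> (complex ^ 'n) set \<Rightarrow> (complex ^ 'm) set \<Rightarrow> bool" where
  "biholomorphic_map F W W' \<longleftrightarrow>
     open W \<and> open W' \<and> bij_betw F W W' \<and>
     holomorphic_map_on F W \<and> holomorphic_map_on (inv_into W F) W'"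

end

theory Submission
  imports Defs "HOL-Complex_Analysis.Complex_Analysis"
begin

text \<open>
  Write \<open>H\<close> for the inverse of \<open>F\<close>. The defining function of \<open>F ` U\<close> is \<open>r \<circ> H\<close>, approximated by
  \<open>R m \<circ> H\<close>, on the images of two relatively compact neighbourhoods of the boundary of \<open>U\<close>. On these
  the derivatives of \<open>F\<close> and \<open>H\<close> are bounded, so the gradients of \<open>R m \<circ> H\<close> stay bounded and
  bounded away from zero uniformly in \<open>m\<close>. The heart of the matter is that composing a \<open>C\<^sup>1\<close>
  function \<open>u\<close> with \<open>H\<close> preserves uniform plurisubharmonicity on average
  (\<open>uniformly_psh_pullback\<close>).

  This rests on a comparison of two images of a small circle. The circle \<open>a + e\<^sup>i\<^sup>\<theta> b\<close> is mapped by \<open>H\<close> to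
  \<open>Q(\<theta>) = P(\<theta>) + E(\<theta>)\<close>, where \<open>P(\<theta>) = H(a) + e\<^sup>i\<^sup>\<theta> DH(a) b\<close> is again a circle in a complex line
  and the error \<open>E\<close> has two properties: \<open>\<bar>E\<bar> \<le> C \<bar>b\<bar>\<^sup>2\<close> by the Cauchy estimates
  (\<open>holomorphic_map_remainder\<close>), and \<open>E\<close> has mean zero by the mean value property
  (\<open>holomorphic_map_circle_mean\<close>). The hypothesis on \<open>u\<close> bounds the mean of \<open>u \<circ> P\<close> from below by
  \<open>u(H(a)) + L \<bar>DH(a) b\<bar>\<^sup>2\<close>. Replacing \<open>P\<close> by \<open>Q\<close> changes \<open>u\<close> by \<open>\<nabla>u(H(a0)) \<bullet> E(\<theta>)\<close>, which averages
  to zero, up to an error \<open>\<eta> \<bar>E\<bar> \<le> \<eta> C \<bar>b\<bar>\<^sup>2\<close>; here \<open>\<eta>\<close> is the oscillation of \<open>\<nabla>u\<close> near \<open>H(a0)\<close>,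
  which is as small as desired because \<open>u\<close> is \<open>C\<^sup>1\<close>. If \<open>\<bar>DH(a) b\<bar> \<ge> c \<bar>b\<bar>\<close>, every constant
  \<open>L' < L c\<^sup>2\<close> therefore works for \<open>u \<circ> H\<close>. How small \<open>b\<close> must be depends on \<open>u\<close>, but \<open>L'\<close> does
  not, so one \<open>L'\<close> serves the whole sequence.
\<close>

section \<open>Holomorphic maps of several variables\<close>

lemma holomorphic_map_has_derivative:
  assumes "holomorphic_map_on F W" "z \<in> W"
  shows "(F has_derivative frechet_derivative F (at z)) (at z)"
  using assms unfolding holomorphic_map_on_def
  by (metis frechet_derivative_at)

lemma holomorphic_map_derivative_scale:
  assumes "holomorphic_map_on F W" "z \<in> W"
  shows "frechet_derivative F (at z) (c *s b) = c *s frechet_derivative F (at z) b"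
proof -
  obtain T where T: "(F has_derivative T) (at z)" "Vector_Spaces.linear (*s) (*s) T"
    using assms unfolding holomorphic_map_on_def by blast
  have "frechet_derivative F (at z) = T"
    using T(1) by (metis frechet_derivative_at)
  then show ?thesis
    using T(2) by (simp add: Vector_Spaces.linear_iff)
qed

lemma holomorphic_map_continuous:
  assumes "holomorphic_map_on F W"
  shows "continuous_on W F"
  using holomorphic_map_has_derivative[OF assms]
  by (meson continuous_at_imp_continuous_on has_derivative_continuous)

lemma holomorphic_map_line:
  fixes F :: "complex ^ 'n \<Rightarrow> complex ^ 'm"
  assumes "holomorphic_map_on F W" "a + t *s b \<in> W"
  shows "((\<lambda>t. F (a + t *s b) $ k) has_field_derivative
            frechet_derivative F (at (a + t *s b)) b $ k) (at t)"
proof -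
  have line: "((\<lambda>t. a + t *s b) has_derivative (\<lambda>h. h *s b)) (at t)"
  proof -
    have "linear (\<lambda>h :: complex. h *s b)"
      by (intro linearI) (simp_all add: vec_eq_iff algebra_simps)
    then have "((\<lambda>t :: complex. t *s b) has_derivative (\<lambda>h. h *s b)) (at t)"
      by (intro bounded_linear_imp_has_derivative) (simp add: linear_conv_bounded_linear)
    from has_derivative_add[OF has_derivative_const[of a] this] show ?thesis by simp
  qed
  have "((\<lambda>t. F (a + t *s b)) has_derivative
          (\<lambda>h. frechet_derivative F (at (a + t *s b)) (h *s b))) (at t)"
    using has_derivative_compose[OF line holomorphic_map_has_derivative[OF assms]] .
  then have "((\<lambda>t. F (a + t *s b) $ k) has_derivative
          (\<lambda>h. frechet_derivative F (at (a + t *s b)) (h *s b) $ k)) (at t)"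
    by (rule bounded_linear.has_derivative[OF bounded_linear_vec_nth])
  then show ?thesis
    by (simp add: has_field_derivative_def holomorphic_map_derivative_scale[OF assms] mult_commute_abs)
qed

lemma holomorphic_map_line_holomorphic:
  fixes F :: "complex ^ 'n \<Rightarrow> complex ^ 'm"
  assumes "holomorphic_map_on F W" "\<And>t. t \<in> S \<Longrightarrow> a + t *s b \<in> W"
  shows "(\<lambda>t. F (a + t *s b) $ k) holomorphic_on S"
  unfolding holomorphic_on_def
proof
  fix t assume "t \<in> S"
  have "(\<lambda>t. F (a + t *s b) $ k) field_differentiable at t"
    unfolding field_differentiable_def
    using holomorphic_map_line[OF assms(1) assms(2)[OF \<open>t \<in> S\<close>]] by blast
  then show "(\<lambda>t. F (a + t *s b) $ k) field_differentiable at t within S"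
    by (rule field_differentiable_at_within)
qed

lemma norm_vector_scalar_mult:
  fixes b :: "complex ^ 'n"
  shows "norm (t *s b) = norm t * norm b"
  by (simp add: norm_vec_def norm_mult L2_set_right_distrib)

lemma norm_vec_le_card:
  fixes x :: "complex ^ 'n"
  assumes "\<And>k. norm (x $ k) \<le> B"
  shows "norm x \<le> real CARD('n) * B"
proof -
  have "norm x \<le> (\<Sum>k\<in>UNIV. norm (x $ k))"
    unfolding norm_vec_def by (rule L2_set_le_sum) auto
  also have "\<dots> \<le> real CARD('n) * B"
    using sum_bounded_above[of UNIV "\<lambda>k. norm (x $ k)" B] assms by auto
  finally show ?thesis .
qed

text \<open>
  Cauchy's estimates for a disc that is large compared with the unit step: the powers of \<open>1 / R\<close> turn
  into powers of the length of \<open>b\<close> once a map is restricted to the complex line in direction \<open>b\<close>.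
\<close>

lemma Cauchy_first_order_bound:
  assumes "f holomorphic_on ball 0 R" "R \<ge> 2" and B: "\<And>t. t \<in> ball 0 R \<Longrightarrow> norm (f t) \<le> B"
  shows "norm (f 1 - f 0 - deriv f 0) \<le> 32 * B / R\<^sup>2" "norm (deriv f 0) \<le> 4 * B / R"
proof -
  \<comment> \<open>Discs of radius \<open>R / 4\<close> around points of the closed unit disc stay inside \<open>ball 0 R\<close>; this radius
    produces the constants 4 and \<open>32 = 2 * 4\<^sup>2\<close>.\<close>
  have R: "0 < R" "0 < R / 4" "1 + R / 4 < R"
    using assms(2) by auto
  have sub: "cball x (R / 4) \<subseteq> ball 0 R" if "x \<in> cball 0 1" for x :: complex
  proof
    fix y assume "y \<in> cball x (R / 4)"
    then have "norm (y - x) \<le> R / 4" by (simp add: dist_norm norm_minus_commute)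
    then show "y \<in> ball 0 R"
      using that R norm_triangle_ineq[of "y - x" x] by auto
  qed
  have est: "norm ((deriv ^^ n) f x) \<le> fact n * B / (R / 4) ^ n" if "x \<in> cball 0 1" for x n
  proof (rule Cauchy_inequality)
    show "f holomorphic_on ball x (R / 4)"
      using assms(1) sub[OF that] by (meson ball_subset_cball holomorphic_on_subset)
    show "continuous_on (cball x (R / 4)) f"
      using assms(1) sub[OF that] by (meson holomorphic_on_imp_continuous_on holomorphic_on_subset)
    show "norm (f y) \<le> B" if "norm (x - y) = R / 4" for y
      using sub[OF \<open>x \<in> cball 0 1\<close>] that by (intro B) (auto simp: dist_norm)
  qed (use R in auto)
  show "norm (deriv f 0) \<le> 4 * B / R"
    using est[of 0 1] by (simp add: field_simps)
  have d: "((deriv ^^ i) f has_field_derivative (deriv ^^ Suc i) f x) (at x within cball 0 1)"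
    if "x \<in> cball 0 1" for x i
  proof -
    have "((deriv ^^ i) f) holomorphic_on ball 0 R"
      using assms(1) by (intro holomorphic_higher_deriv) auto
    moreover have "x \<in> ball 0 R" using that R by auto
    ultimately have "((deriv ^^ i) f has_field_derivative deriv ((deriv ^^ i) f) x) (at x)"
      by (intro holomorphic_derivI[where S = "ball 0 R"]) auto
    then show ?thesis by (simp add: has_field_derivative_at_within)
  qed
  have "norm ((deriv ^^ 0) f 1 - (\<Sum>i\<le>1. (deriv ^^ i) f 0 * (1 - 0) ^ i / fact i))
          \<le> (32 * B / R\<^sup>2) * norm (1 - 0 :: complex) ^ Suc 1 / fact 1"
  proof (rule complex_Taylor)
    show "norm ((deriv ^^ Suc 1) f x) \<le> 32 * B / R\<^sup>2" if "x \<in> cball 0 1" for x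
      using est[OF that, of 2] by (simp add: field_simps power2_eq_square eval_nat_numeral)
  qed (use d in auto)
  then show "norm (f 1 - f 0 - deriv f 0) \<le> 32 * B / R\<^sup>2"
    by (simp add: algebra_simps)
qed

text \<open>
  The bounds are uniform in the base point \<open>a\<close>. They come from one variable: along
  \<open>t \<mapsto> F (a + t *s b)\<close> each component is bounded on a disc whose radius is a fixed multiple of
  \<open>1 / norm b\<close>, and the one-variable estimates are evaluated at \<open>t = 1\<close>.
\<close>

lemma holomorphic_map_remainder:
  fixes F :: "complex ^ 'n \<Rightarrow> complex ^ 'm"
  assumes F: "holomorphic_map_on F W" and "open W" "a0 \<in> W"
  obtains C d where "C > 0" "d > 0" "ball a0 (2 * d) \<subseteq> W"
    "\<And>a b. \<lbrakk>a \<in> ball a0 d; norm b < d\<rbrakk> \<Longrightarrow>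
       norm (F (a + b) - F a - frechet_derivative F (at a) b) \<le> C * (norm b)\<^sup>2"
    "\<And>a b. \<lbrakk>a \<in> ball a0 d; norm b < d\<rbrakk> \<Longrightarrow> norm (frechet_derivative F (at a) b) \<le> C * norm b"
proof -
  obtain \<rho> where \<rho>: "\<rho> > 0" "cball a0 \<rho> \<subseteq> W"
    using assms open_contains_cball by blast
  have "compact (F ` cball a0 \<rho>)"
    using holomorphic_map_continuous[OF F] \<rho>(2)
    by (meson compact_cball compact_continuous_image continuous_on_subset)
  then have "bounded (F ` cball a0 \<rho>)" by (rule compact_imp_bounded)
  then obtain B where B: "B > 0" "\<And>z. z \<in> cball a0 \<rho> \<Longrightarrow> norm (F z) \<le> B"
    by (auto simp: bounded_pos)
  define K where "K = real CARD('m) * (128 * B / \<rho>\<^sup>2 + 8 * B / \<rho>)"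
  have K: "K > 0" using \<rho>(1) B(1) by (auto simp: K_def intro!: mult_pos_pos add_pos_pos)
  have main: "norm (F (a + b) - F a - frechet_derivative F (at a) b) \<le> K * (norm b)\<^sup>2 \<and>
              norm (frechet_derivative F (at a) b) \<le> K * norm b"
    if a: "a \<in> ball a0 (\<rho> / 4)" and b: "norm b < \<rho> / 4" for a b
  proof (cases "b = 0")
    case True
    have "a \<in> W" using a \<rho> by (auto simp: subset_eq)
    then have "frechet_derivative F (at a) 0 = 0"
      by (intro linear_0 has_derivative_linear[OF holomorphic_map_has_derivative[OF F]])
    then show ?thesis using True by simp
  next
    case False
    define R where "R = (\<rho> / 2) / norm b"
    have R: "R \<ge> 2" using False b by (simp add: R_def field_simps)
    have inW: "a + t *s b \<in> cball a0 \<rho>" if "t \<in> ball 0 R" for t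
    proof -
      have "norm t * norm b \<le> \<rho> / 2"
        using that False by (simp add: R_def field_simps)
      then have "norm (t *s b) \<le> \<rho> / 2" by (simp add: norm_vector_scalar_mult)
      moreover have "norm (a - a0) < \<rho> / 4" using a by (simp add: dist_norm norm_minus_commute)
      ultimately have "norm ((a - a0) + t *s b) \<le> \<rho>"
        using norm_triangle_ineq[of "a - a0" "t *s b"] \<rho>(1) by linarith
      then show ?thesis by (simp add: dist_norm norm_minus_commute[of a0] algebra_simps)
    qed
    have comp: "norm (F (a + b) $ k - F a $ k - frechet_derivative F (at a) b $ k) \<le> 32 * B / R\<^sup>2
        \<and> norm (frechet_derivative F (at a) b $ k) \<le> 4 * B / R" for k
    proof -
      let ?f = "\<lambda>t. F (a + t *s b) $ k"
      have der: "(?f has_field_derivative frechet_derivative F (at (a + t *s b)) b $ k) (at t)"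
        if "t \<in> ball 0 R" for t
        using inW[OF that] \<rho>(2) by (intro holomorphic_map_line[OF F]) auto
      have hol: "?f holomorphic_on ball 0 R"
        using inW \<rho>(2) by (intro holomorphic_map_line_holomorphic[OF F]) auto
      have bd: "norm (?f t) \<le> B" if "t \<in> ball 0 R" for t
        by (rule order_trans[OF Finite_Cartesian_Product.norm_nth_le B(2)[OF inW[OF that]]])
      have "deriv ?f 0 = frechet_derivative F (at a) b $ k"
        using der[of 0] R by (intro DERIV_imp_deriv) auto
      then show ?thesis
        using Cauchy_first_order_bound[OF hol R bd] by simp
    qed
    have e1: "32 * B / R\<^sup>2 = (128 * B / \<rho>\<^sup>2) * (norm b)\<^sup>2"
      using \<rho>(1) False by (simp add: R_def field_simps power2_eq_square)
    have e2: "4 * B / R = (8 * B / \<rho>) * norm b"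
      using \<rho>(1) False by (simp add: R_def field_simps)
    have "norm (F (a + b) - F a - frechet_derivative F (at a) b) \<le> real CARD('m) * (32 * B / R\<^sup>2)"
      using comp by (intro norm_vec_le_card) auto
    also have "\<dots> \<le> K * (norm b)\<^sup>2"
      unfolding e1 K_def using \<rho>(1) B(1)
      by (simp add: algebra_simps)
    finally have 1: "norm (F (a + b) - F a - frechet_derivative F (at a) b) \<le> K * (norm b)\<^sup>2" .
    have "norm (frechet_derivative F (at a) b) \<le> real CARD('m) * (4 * B / R)"
      using comp by (intro norm_vec_le_card) auto
    also have "\<dots> \<le> K * norm b"
      unfolding e2 K_def using \<rho>(1) B(1)
      by (simp add: algebra_simps)
    finally show ?thesis using 1 by blast
  qed
  show ?thesis
  proof (rule that[of K "\<rho> / 4"])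
    show "ball a0 (2 * (\<rho> / 4)) \<subseteq> W"
      using \<rho> by (auto simp: subset_eq)
  qed (use K \<rho> main in auto)
qed

text \<open>
  The mean value property, from Cauchy's integral formula at the centre of the disc.
\<close>

lemma holomorphic_map_circle_mean:
  fixes F :: "complex ^ 'n \<Rightarrow> complex ^ 'm"
  assumes F: "holomorphic_map_on F W" and disc: "\<And>t. t \<in> cball 0 1 \<Longrightarrow> a + t *s b \<in> W"
  shows "((\<lambda>\<theta>. F (a + exp (\<i> * complex_of_real \<theta>) *s b)) has_integral (2 * pi) *\<^sub>R F a) {0..2 * pi}"
proof -
  have comp: "((\<lambda>\<theta>. F (a + exp (\<i> * complex_of_real \<theta>) *s b) $ k) has_integral (2 * pi) *\<^sub>R F a $ k) {0..2 * pi}" for k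
  proof -
    let ?f = "\<lambda>t. F (a + t *s b) $ k"
    have hol: "?f holomorphic_on cball 0 1"
      using disc by (rule holomorphic_map_line_holomorphic[OF F])
    have "((\<lambda>u. ?f u / (u - 0)) has_contour_integral (2 * of_real pi * \<i> * ?f 0)) (circlepath 0 1)"
      using hol by (intro Cauchy_integral_circlepath_simple) auto
    then have "((\<lambda>t. ?f (cis t) * \<i>) has_integral (2 * of_real pi * \<i> * ?f 0)) {0..2 * pi}"
      unfolding circlepath_def
      by (simp add: has_contour_integral_part_circlepath_iff mult_ac)
    from has_integral_mult_right[OF this, of "- \<i>"]
    show ?thesis
      by (simp add: cis_conv_exp scaleR_conv_of_real mult_ac)
  qed
  show ?thesis
  proof (subst has_integral_componentwise_iff, rule ballI)
    fix e :: "complex ^ 'm" assume "e \<in> Basis"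
    then obtain k v where e: "e = axis k v" by (auto simp: Basis_vec_def)
    show "((\<lambda>\<theta>. F (a + exp (\<i> * complex_of_real \<theta>) *s b) \<bullet> e) has_integral ((2 * pi) *\<^sub>R F a) \<bullet> e) {0..2 * pi}"
      unfolding e inner_axis
      using has_integral_linear[OF comp[of k] bounded_linear_inner_left[of v]]
      by (simp only: o_def inner_scaleR_left vector_scaleR_component)
  qed
qed


text \<open>
  Complex differentiability at each point already forces the derivative to be continuous: by the
  uniform remainder estimate, the difference quotients, which are continuous, converge locally
  uniformly to it.
\<close>

lemma holomorphic_map_derivative_continuous:
  fixes F :: "complex ^ 'n \<Rightarrow> complex ^ 'm"
  assumes F: "holomorphic_map_on F W" and "open W"
  shows "continuous_on W (\<lambda>z. frechet_derivative F (at z) b)"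
proof (rule continuous_at_imp_continuous_on, rule ballI)
  fix a0 assume "a0 \<in> W"
  then obtain C d where C: "C > 0" and d: "d > 0" "ball a0 (2 * d) \<subseteq> W"
    and rem: "\<And>a b. \<lbrakk>a \<in> ball a0 d; norm b < d\<rbrakk> \<Longrightarrow>
       norm (F (a + b) - F a - frechet_derivative F (at a) b) \<le> C * (norm b)\<^sup>2"
    using holomorphic_map_remainder[OF F \<open>open W\<close>] by metis
  let ?q = "\<lambda>h a. (1 / h) *\<^sub>R (F (a + h *\<^sub>R b) - F a)"
  have small: "\<forall>\<^sub>F h in at_right 0. 0 < h \<and> h * norm b < d \<and> C * (norm b)\<^sup>2 * h < e" if "e > 0" for e
  proof -
    have "((\<lambda>h. h * norm b) \<longlongrightarrow> 0 * norm b) (at_right 0)"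
      by (intro tendsto_intros)
    then have 1: "\<forall>\<^sub>F h in at_right 0. h * norm b < d"
      using d(1) by (simp add: order_tendstoD(2))
    have "((\<lambda>h. C * (norm b)\<^sup>2 * h) \<longlongrightarrow> C * (norm b)\<^sup>2 * 0) (at_right 0)"
      by (intro tendsto_intros)
    then have 2: "\<forall>\<^sub>F h in at_right 0. C * (norm b)\<^sup>2 * h < e"
      using that by (simp add: order_tendstoD(2))
    show ?thesis
      using 1 2 eventually_at_right_less[of 0] by eventually_elim auto
  qed
  have "uniform_limit (ball a0 d) ?q (\<lambda>a. frechet_derivative F (at a) b) (at_right 0)"
  proof (rule uniform_limitI)
    fix e :: real assume "e > 0"
    from small[OF this] show "\<forall>\<^sub>F h in at_right 0. \<forall>a\<in>ball a0 d. dist (?q h a) (frechet_derivative F (at a) b) < e"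
    proof eventually_elim
      case (elim h)
      show ?case
      proof
        fix a assume a: "a \<in> ball a0 d"
        then have "a \<in> W" using d by auto
        then have lin: "frechet_derivative F (at a) (h *\<^sub>R b) = h *\<^sub>R frechet_derivative F (at a) b"
          by (intro linear_scale has_derivative_linear[OF holomorphic_map_has_derivative[OF F]])
        have "norm (F (a + h *\<^sub>R b) - F a - h *\<^sub>R frechet_derivative F (at a) b) \<le> C * (norm (h *\<^sub>R b))\<^sup>2"
          using rem[OF a, of "h *\<^sub>R b"] elim by (simp add: lin)
        also have "\<dots> < h * e"
          using elim by (simp add: power_mult_distrib power2_eq_square mult_ac)
        finally have "norm (F (a + h *\<^sub>R b) - F a - h *\<^sub>R frechet_derivative F (at a) b) < h * e" .
        moreover have "?q h a - frechet_derivative F (at a) b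
            = (1 / h) *\<^sub>R (F (a + h *\<^sub>R b) - F a - h *\<^sub>R frechet_derivative F (at a) b)"
          using elim by (simp add: scaleR_diff_right)
        then have "norm (?q h a - frechet_derivative F (at a) b)
            = (1 / h) * norm (F (a + h *\<^sub>R b) - F a - h *\<^sub>R frechet_derivative F (at a) b)"
          using elim by (simp only: norm_scaleR) simp
        ultimately show "dist (?q h a) (frechet_derivative F (at a) b) < e"
          using elim by (simp add: dist_norm divide_less_eq mult.commute del: scaleR_diff_right)
      qed
    qed
  qed
  moreover have "\<forall>\<^sub>F h in at_right 0. continuous_on (ball a0 d) (?q h)"
    using small[of 1, simplified]
  proof eventually_elim
    case (elim h)
    have "a + h *\<^sub>R b \<in> W" if "a \<in> ball a0 d" for a
    proof -
      have "norm (h *\<^sub>R b) < d" using elim by simp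
      then have "a + h *\<^sub>R b \<in> ball a0 (2 * d)"
        using that norm_triangle_ineq[of "a - a0" "h *\<^sub>R b"]
        by (simp add: dist_norm norm_minus_commute[of a0] algebra_simps)
      then show ?thesis using d by auto
    qed
    moreover have "ball a0 d \<subseteq> W" using d by (auto simp: subset_eq)
    ultimately show ?case
      by (intro continuous_intros continuous_on_compose2[OF holomorphic_map_continuous[OF F]]) auto
  qed
  ultimately have "continuous_on (ball a0 d) (\<lambda>a. frechet_derivative F (at a) b)"
    by (intro uniform_limit_theorem[where F = "at_right (0::real)"]) auto
  then show "isCont (\<lambda>a. frechet_derivative F (at a) b) a0"
    using d(1) by (simp add: continuous_on_eq_continuous_at)
qed

lemma holomorphic_map_derivative_bounded:
  fixes F :: "complex ^ 'n \<Rightarrow> complex ^ 'm"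
  assumes F: "holomorphic_map_on F W" and "open W" "compact K" "K \<subseteq> W"
  obtains B where "B > 0" "\<And>z b. z \<in> K \<Longrightarrow> norm (frechet_derivative F (at z) b) \<le> B * norm b"
proof -
  let ?D = "\<lambda>z. frechet_derivative F (at z)"
  let ?s = "\<lambda>z. \<Sum>i\<in>Basis. norm (?D z i)"
  have "continuous_on K ?s"
    using holomorphic_map_derivative_continuous[OF F \<open>open W\<close>] \<open>K \<subseteq> W\<close>
    by (intro continuous_intros) (auto intro: continuous_on_subset)
  then have "bounded (?s ` K)"
    using \<open>compact K\<close> by (intro compact_imp_bounded compact_continuous_image)
  then obtain B where B: "B > 0" "\<And>z. z \<in> K \<Longrightarrow> \<bar>?s z\<bar> \<le> B"
    by (auto simp: bounded_pos)
  show ?thesis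
  proof (rule that[OF B(1)])
    fix z b assume z: "z \<in> K"
    have lin: "linear (?D z)"
      using z \<open>K \<subseteq> W\<close> by (intro has_derivative_linear[OF holomorphic_map_has_derivative[OF F]]) auto
    have "?D z b = ?D z (\<Sum>i\<in>Basis. (b \<bullet> i) *\<^sub>R i)"
      by (simp only: euclidean_representation)
    also have "\<dots> = (\<Sum>i\<in>Basis. (b \<bullet> i) *\<^sub>R ?D z i)"
      by (simp only: linear_sum[OF lin] linear_scale[OF lin])
    also have "norm \<dots> \<le> (\<Sum>i\<in>Basis. norm b * norm (?D z i))"
      by (intro sum_norm_le) (auto intro!: mult_right_mono Basis_le_norm)
    also have "\<dots> = ?s z * norm b"
      by (simp add: sum_distrib_left mult.commute)
    also have "\<dots> \<le> B * norm b"
      using B(2)[OF z] by (intro mult_right_mono) auto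
    finally show "norm (?D z b) \<le> B * norm b" .
  qed
qed

section \<open>Pulling back uniform plurisubharmonicity on average\<close>

text \<open>
  A radius that exists locally uniformly can be chosen lower semicontinuous: take at \<open>a\<close> the supremum
  of all radii (at most 1, to keep it finite) that work on some neighbourhood of \<open>a\<close>. A radius
  admissible at \<open>a\<close> is admissible at all nearby points, hence the semicontinuity.
\<close>

lemma locally_uniform_radius_lsc:
  fixes P :: "'a::topological_space \<Rightarrow> real \<Rightarrow> bool"
  assumes loc: "\<And>a0. a0 \<in> V \<Longrightarrow> \<exists>d>0. \<exists>N. open N \<and> a0 \<in> N \<and> (\<forall>a\<in>N. \<forall>s<d. P a s)"
  obtains \<delta> where "lsc_on V \<delta>" "\<And>a. a \<in> V \<Longrightarrow> 0 < \<delta> a" "\<And>a s. \<lbrakk>a \<in> V; s < \<delta> a\<rbrakk> \<Longrightarrow> P a s"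
proof -
  define D where "D a = {d \<in> {0<..1}. \<exists>N. open N \<and> a \<in> N \<and> (\<forall>a'\<in>N. \<forall>s<d. P a' s)}" for a
  have bdd: "bdd_above (D a)" for a
    by (rule bdd_aboveI[of _ 1]) (auto simp: D_def)
  have ne: "D a \<noteq> {}" if a: "a \<in> V" for a
  proof -
    obtain d N where "d > 0" "open N" "a \<in> N" "\<forall>a'\<in>N. \<forall>s<d. P a' s" using loc[OF a] by blast
    then have "min d 1 \<in> D a" by (auto simp: D_def)
    then show ?thesis by blast
  qed
  have iff: "c < Sup (D a) \<longleftrightarrow> (\<exists>d\<in>D a. c < d)" if "a \<in> V" for a c
    by (rule less_cSup_iff[OF ne[OF that] bdd])
  show ?thesis
  proof (rule that[of "\<lambda>a. Sup (D a)"])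
    show "lsc_on V (\<lambda>a. Sup (D a))"
      unfolding lsc_on_def
    proof
      fix c
      show "openin (top_of_set V) {x \<in> V. c < Sup (D x)}"
      proof (subst openin_subopen, rule ballI)
        fix x assume "x \<in> {x \<in> V. c < Sup (D x)}"
        then obtain d where x: "x \<in> V" "d \<in> D x" "c < d" using iff by auto
        then obtain N where N: "open N" "x \<in> N" "\<forall>a'\<in>N. \<forall>s<d. P a' s" by (auto simp: D_def)
        have "V \<inter> N \<subseteq> {x \<in> V. c < Sup (D x)}"
        proof
          fix y assume y: "y \<in> V \<inter> N"
          then have "d \<in> D y" using N x(2) by (auto simp: D_def)
          then show "y \<in> {x \<in> V. c < Sup (D x)}" using y iff x(3) by auto
        qed
        then show "\<exists>T. openin (top_of_set V) T \<and> x \<in> T \<and> T \<subseteq> {x \<in> V. c < Sup (D x)}"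
          using N x(1) by (intro exI[of _ "V \<inter> N"]) auto
      qed
    qed
    show "0 < Sup (D a)" if "a \<in> V" for a
      using ne[OF that] iff[OF that, of 0] by (auto simp: D_def)
    show "P a s" if "a \<in> V" "s < Sup (D a)" for a s
      using that iff by (auto simp: D_def)
  qed
qed

text \<open>
  The mean value inequality for \<open>u\<close> minus the linear function with gradient \<open>g\<close>. Freezing \<open>g\<close>, rather than using
  the gradient at \<open>P\<close>, is what later makes the linear term average to zero over a circle of varying
  points \<open>P\<close>.
\<close>

lemma C1_linear_approximation:
  assumes u: "C1_with_gradient V u G" and "convex S" "S \<subseteq> V"
    and G: "\<And>p. p \<in> S \<Longrightarrow> norm (G p - g) \<le> \<eta>" and PQ: "P \<in> S" "Q \<in> S"
  shows "\<bar>u Q - u P - (Q - P) \<bullet> g\<bar> \<le> \<eta> * norm (Q - P)"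
proof -
  have "norm ((u Q - Q \<bullet> g) - (u P - P \<bullet> g)) \<le> \<eta> * norm (Q - P)"
  proof (rule differentiable_bound[OF \<open>convex S\<close>, where f' = "\<lambda>x h. h \<bullet> G x - h \<bullet> g"])
    fix x assume x: "x \<in> S"
    have "(u has_derivative (\<lambda>h. h \<bullet> G x)) (at x within S)"
      using u x \<open>S \<subseteq> V\<close> by (auto simp: C1_with_gradient_def gderiv_def intro: has_derivative_at_withinI)
    then show "((\<lambda>x. u x - x \<bullet> g) has_derivative (\<lambda>h. h \<bullet> G x - h \<bullet> g)) (at x within S)"
      by (intro derivative_intros)
    show "onorm (\<lambda>h. h \<bullet> G x - h \<bullet> g) \<le> \<eta>"
    proof (rule onorm_bound)
      show "0 \<le> \<eta>" using G[OF x] norm_ge_zero order_trans by blast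
      show "norm (h \<bullet> G x - h \<bullet> g) \<le> \<eta> * norm h" for h
        using Cauchy_Schwarz_ineq2[of h "G x - g"] mult_left_mono[OF G[OF x], of "norm h"]
        by (simp add: inner_diff_right mult.commute)
    qed
  qed (use PQ in auto)
  then show ?thesis by (simp add: inner_diff_left algebra_simps)
qed


text \<open>
  The perturbation argument with remainder \<open>E = Q - P\<close> of mean zero and size
  \<open>C * (norm b)\<^sup>2\<close>. The slack \<open>L * c\<^sup>2 - L'\<close> pays for the oscillation of the gradient.
\<close>

lemma uniformly_psh_pullback_locally:
  fixes H :: "complex ^ 'n \<Rightarrow> complex ^ 'm" and u :: "complex ^ 'm \<Rightarrow> real"
  assumes H: "holomorphic_map_on H V'" and "open V'" "open V" "H ` V' \<subseteq> V"
    and psh: "uniformly_psh_on_average L V (\<lambda>z. ereal (u z))"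
    and u: "C1_with_gradient V u G"
    and low: "c \<ge> 0" "\<And>w b. w \<in> V' \<Longrightarrow> c * norm b \<le> norm (frechet_derivative H (at w) b)"
    and L': "L' < L * c\<^sup>2" and a0: "a0 \<in> V'"
  obtains d where "d > 0" "ball a0 (2 * d) \<subseteq> V'"
    "\<And>a b. \<lbrakk>a \<in> ball a0 d; norm b < d\<rbrakk> \<Longrightarrow>
       L' * (norm b)\<^sup>2 + u (H a) \<le>
         1 / (2 * pi) * integral {0..2 * pi} (\<lambda>\<theta>. u (H (a + exp (\<i> * complex_of_real \<theta>) *s b)))"
proof -
  let ?D = "\<lambda>a. frechet_derivative H (at a)" and ?p = "H a0"
  let ?e = "\<lambda>\<theta>. exp (\<i> * complex_of_real \<theta>)"
  have e_norm: "norm (?e \<theta>) = 1" for \<theta>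
    by simp
  have cont_u: "continuous_on V u"
    using u by (auto simp: C1_with_gradient_def gderiv_def
        intro!: continuous_at_imp_continuous_on has_derivative_continuous)
  have cont_H: "continuous_on V' H" by (rule holomorphic_map_continuous[OF H])
  obtain \<delta> where \<delta>: "lsc_on V \<delta>" "\<And>z. z \<in> V \<Longrightarrow> \<delta> z > 0"
    and mean: "\<And>a b. \<lbrakk>a \<in> V; norm b < \<delta> a\<rbrakk> \<Longrightarrow>
       ereal (L * (norm b)\<^sup>2) + ereal (u a) \<le> circle_mean (\<lambda>\<theta>. ereal (u (a + ?e \<theta> *s b)))"
    and "L > 0"
    using psh unfolding uniformly_psh_on_average_def by blast
  have p: "?p \<in> V" using a0 \<open>H ` V' \<subseteq> V\<close> by auto
  \<comment> \<open>Lower semicontinuity of \<open>\<delta>\<close> gives one admissible radius \<open>s\<close> for all points near \<open>?p\<close>.\<close>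
  define s where "s = \<delta> ?p / 2"
  have s: "s > 0" using \<delta>(2)[OF p] by (simp add: s_def)
  define S where "S = {x \<in> V. s < \<delta> x}"
  have "open S"
    using \<delta>(1) \<open>open V\<close> openin_open_eq unfolding lsc_on_def S_def by blast
  moreover have "?p \<in> S" using p \<delta>(2)[OF p] by (simp add: S_def s_def)
  ultimately obtain \<rho>1 where \<rho>1: "\<rho>1 > 0" "ball ?p \<rho>1 \<subseteq> S"
    by (meson open_contains_ball)
  obtain C d1 where C: "C > 0" and d1: "d1 > 0" "ball a0 (2 * d1) \<subseteq> V'"
    and rem: "\<And>a b. \<lbrakk>a \<in> ball a0 d1; norm b < d1\<rbrakk> \<Longrightarrow>
       norm (H (a + b) - H a - ?D a b) \<le> C * (norm b)\<^sup>2"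
    and Dle: "\<And>a b. \<lbrakk>a \<in> ball a0 d1; norm b < d1\<rbrakk> \<Longrightarrow> norm (?D a b) \<le> C * norm b"
    using holomorphic_map_remainder[OF H \<open>open V'\<close> a0] by metis
  \<comment> \<open>The oscillation of the gradient that the slack between \<open>L'\<close> and \<open>L * c\<^sup>2\<close> allows.\<close>
  define \<eta> where "\<eta> = (L * c\<^sup>2 - L') / C"
  have \<eta>: "\<eta> > 0" "\<eta> * C = L * c\<^sup>2 - L'" using L' C by (auto simp: \<eta>_def)
  have "isCont G ?p"
    using u p \<open>open V\<close> by (simp add: C1_with_gradient_def continuous_on_eq_continuous_at)
  then obtain \<rho>2 where \<rho>2: "\<rho>2 > 0" "\<And>x. dist x ?p < \<rho>2 \<Longrightarrow> dist (G x) (G ?p) < \<eta>"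
    using \<eta>(1) unfolding continuous_at_eps_delta by blast
  define \<rho> where "\<rho> = min \<rho>1 \<rho>2"
  have \<rho>: "\<rho> > 0" "ball ?p \<rho> \<subseteq> S" "ball ?p \<rho> \<subseteq> V"
    using \<rho>1 \<rho>2 by (auto simp: \<rho>_def S_def)
  have Gclose: "norm (G x - G ?p) \<le> \<eta>" if "x \<in> ball ?p \<rho>" for x
    using that \<rho>2(2)[of x] by (simp add: \<rho>_def dist_norm norm_minus_commute[of ?p])
  have "isCont H a0"
    using cont_H a0 \<open>open V'\<close> by (simp add: continuous_on_eq_continuous_at)
  then obtain d2 where d2: "d2 > 0" "\<And>x. dist x a0 < d2 \<Longrightarrow> dist (H x) ?p < \<rho> / 2"
    using \<rho>(1) unfolding continuous_at_eps_delta by (meson half_gt_zero)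
  \<comment> \<open>The last two bounds keep \<open>P\<close> in the ball of radius \<open>\<rho>\<close> and \<open>norm (T b)\<close> below \<open>s\<close>.\<close>
  define d where "d = min (min d1 (d2 / 2)) (min (\<rho> / (2 * C)) (s / C))"
  have d: "d > 0" "d \<le> d1" "2 * d \<le> d2"
    using d1 d2 \<rho> C s by (auto simp: d_def)
  have "d \<le> \<rho> / (2 * C)" "d \<le> s / C" by (auto simp: d_def)
  then have Cd: "C * d \<le> \<rho> / 2" "C * d \<le> s"
    using C by (auto simp: field_simps)
  show ?thesis
  proof (rule that[OF d(1)])
    show sub: "ball a0 (2 * d) \<subseteq> V'"
      using d1(2) d(2) by (auto simp: subset_eq)
    fix a b :: "complex ^ 'n" assume a: "a \<in> ball a0 d" and b: "norm b < d"
    define T where "T = ?D a"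
    define P where "P \<theta> = H a + ?e \<theta> *s T b" for \<theta>
    define Q where "Q \<theta> = H (a + ?e \<theta> *s b)" for \<theta>
    have aV: "a \<in> V'" using a d(1) sub by auto
    have ad1: "a \<in> ball a0 d1" using a d(2) by auto
    have bd1: "norm b < d1" using b d(2) by auto
    have in_ball: "a + t *s b \<in> ball a0 (2 * d)" if "norm t \<le> 1" for t
    proof -
      have "norm (t *s b) < d"
        using b that mult_right_mono[OF that, of "norm b"] by (simp add: norm_vector_scalar_mult)
      then show ?thesis
        using a norm_triangle_ineq[of "a - a0" "t *s b"]
        by (simp add: dist_norm norm_minus_commute[of a0] algebra_simps)
    qed
    have disc: "a + t *s b \<in> V'" if "t \<in> cball 0 1" for t
      using in_ball[of t] sub that by auto
    have E: "norm (Q \<theta> - P \<theta>) \<le> C * (norm b)\<^sup>2" for \<theta>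
    proof -
      have "T (?e \<theta> *s b) = ?e \<theta> *s T b"
        unfolding T_def by (rule holomorphic_map_derivative_scale[OF H aV])
      then show ?thesis
        using rem[OF ad1, of "?e \<theta> *s b"] bd1
        by (simp add: P_def Q_def T_def norm_vector_scalar_mult diff_diff_eq)
    qed
    have Tb: "norm (T b) \<le> C * norm b"
      unfolding T_def by (rule Dle[OF ad1 bd1])
    have Cb: "C * norm b < C * d" using b C by simp
    have Ha: "dist (H a) ?p < \<rho> / 2"
      using a d by (intro d2) (simp add: dist_commute)
    have Pin: "P \<theta> \<in> ball ?p \<rho>" for \<theta>
    proof -
      have "norm (?e \<theta> *s T b) < \<rho> / 2"
        using Tb Cb Cd(1) by (simp add: norm_vector_scalar_mult)
      then show ?thesis
        using Ha norm_triangle_ineq[of "H a - ?p" "?e \<theta> *s T b"]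
        by (simp add: P_def dist_norm norm_minus_commute[of ?p] algebra_simps)
    qed
    have Qin: "Q \<theta> \<in> ball ?p \<rho>" for \<theta>
    proof -
      have "dist (a + ?e \<theta> *s b) a0 < d2"
        using in_ball[of "?e \<theta>"] d(3) by (simp add: dist_commute)
      from d2(2)[OF this] show ?thesis
        using \<rho>(1) by (simp add: Q_def dist_commute)
    qed
    have approx: "u (P \<theta>) + (Q \<theta> - P \<theta>) \<bullet> G ?p - \<eta> * (C * (norm b)\<^sup>2) \<le> u (Q \<theta>)" for \<theta>
    proof -
      have "\<bar>u (Q \<theta>) - u (P \<theta>) - (Q \<theta> - P \<theta>) \<bullet> G ?p\<bar> \<le> \<eta> * norm (Q \<theta> - P \<theta>)"
        by (rule C1_linear_approximation[OF u convex_ball \<rho>(3) Gclose Pin Qin])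
      also have "\<dots> \<le> \<eta> * (C * (norm b)\<^sup>2)"
        using E \<eta>(1) by (intro mult_left_mono) auto
      finally show ?thesis by linarith
    qed
    have scale: "continuous_on X (\<lambda>\<theta>. ?e \<theta> *s v)" for X and v :: "complex ^ 'k"
      unfolding vector_scalar_mult_def by (intro continuous_intros)
    have contP: "continuous_on {0..2 * pi} (\<lambda>\<theta>. u (P \<theta>))"
      using Pin \<rho>(3) unfolding P_def
      by (intro continuous_on_compose2[OF cont_u] continuous_intros scale) auto
    have contQ: "continuous_on {0..2 * pi} (\<lambda>\<theta>. u (Q \<theta>))"
    proof -
      have "continuous_on {0..2 * pi} Q"
        unfolding Q_def using disc
        by (intro continuous_on_compose2[OF cont_H] continuous_intros scale) auto
      then show ?thesis
        using Qin \<rho>(3) by (intro continuous_on_compose2[OF cont_u]) auto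
    qed
    have "(Q has_integral (2 * pi) *\<^sub>R H a) {0..2 * pi}"
      unfolding Q_def by (rule holomorphic_map_circle_mean[OF H disc])
    moreover have "(P has_integral (2 * pi) *\<^sub>R H a) {0..2 * pi}"
    proof -
      \<comment> \<open>\<open>P\<close> runs along a circle, so the mean value property of the identity map applies.\<close>
      have "holomorphic_map_on (\<lambda>z::complex ^ 'm. z) UNIV"
        unfolding holomorphic_map_on_def
        by (intro ballI exI[of _ "\<lambda>z. z"]) (auto simp: vec.linear_ident)
      from holomorphic_map_circle_mean[OF this, of "H a" "T b"] show ?thesis
        by (simp add: P_def[abs_def])
    qed
    ultimately have "((\<lambda>\<theta>. Q \<theta> - P \<theta>) has_integral 0) {0..2 * pi}"
      using has_integral_diff[of Q "(2 * pi) *\<^sub>R H a" "{0..2 * pi}" P "(2 * pi) *\<^sub>R H a"] by simp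
    from has_integral_linear[OF this bounded_linear_inner_left[of "G ?p"]]
    have zero: "((\<lambda>\<theta>. (Q \<theta> - P \<theta>) \<bullet> G ?p) has_integral 0) {0..2 * pi}"
      by (simp add: o_def)
    have intP: "((\<lambda>\<theta>. u (P \<theta>)) has_integral integral {0..2 * pi} (\<lambda>\<theta>. u (P \<theta>))) {0..2 * pi}"
      by (intro integrable_integral integrable_continuous_real contP)
    have intQ: "((\<lambda>\<theta>. u (Q \<theta>)) has_integral integral {0..2 * pi} (\<lambda>\<theta>. u (Q \<theta>))) {0..2 * pi}"
      by (intro integrable_integral integrable_continuous_real contQ)
    have const: "((\<lambda>\<theta>. \<eta> * (C * (norm b)\<^sup>2)) has_integral 2 * pi * (\<eta> * (C * (norm b)\<^sup>2))) {0..2 * pi}"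
      using has_integral_const_real[of "\<eta> * (C * (norm b)\<^sup>2)" 0 "2 * pi"] by simp
    have "integral {0..2 * pi} (\<lambda>\<theta>. u (P \<theta>)) + 0 - 2 * pi * (\<eta> * (C * (norm b)\<^sup>2))
        \<le> integral {0..2 * pi} (\<lambda>\<theta>. u (Q \<theta>))"
      by (rule has_integral_le[OF has_integral_diff[OF has_integral_add[OF intP zero] const] intQ approx])
    then have compare: "1 / (2 * pi) * integral {0..2 * pi} (\<lambda>\<theta>. u (P \<theta>)) - \<eta> * C * (norm b)\<^sup>2
        \<le> 1 / (2 * pi) * integral {0..2 * pi} (\<lambda>\<theta>. u (Q \<theta>))"
    proof -
      assume "integral {0..2 * pi} (\<lambda>\<theta>. u (P \<theta>)) + 0 - 2 * pi * (\<eta> * (C * (norm b)\<^sup>2))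
        \<le> integral {0..2 * pi} (\<lambda>\<theta>. u (Q \<theta>))"
      from mult_left_mono[OF this, of "1 / (2 * pi)"] show ?thesis
        by (simp add: right_diff_distrib mult.assoc)
    qed
    have "H a \<in> S"
    proof -
      have "H a \<in> ball ?p \<rho>" using Ha \<rho>(1) by (simp add: dist_commute)
      then show ?thesis using \<rho>(2) by blast
    qed
    then have "H a \<in> V" "norm (T b) < \<delta> (H a)"
      using Tb Cb Cd(2) by (auto simp: S_def)
    from mean[OF this] have "L * (norm (T b))\<^sup>2 + u (H a)
        \<le> 1 / (2 * pi) * integral {0..2 * pi} (\<lambda>\<theta>. u (P \<theta>))"
      using circle_mean_ereal[OF contP] by (simp add: P_def)
    moreover have "L * c\<^sup>2 * (norm b)\<^sup>2 \<le> L * (norm (T b))\<^sup>2"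
    proof -
      have "(c * norm b)\<^sup>2 \<le> (norm (T b))\<^sup>2"
        unfolding T_def using low(1) low(2)[OF aV, of b] by (intro power_mono) auto
      then show ?thesis
        using \<open>L > 0\<close> by (simp add: power_mult_distrib)
    qed
    moreover have "\<eta> * C * (norm b)\<^sup>2 = L * c\<^sup>2 * (norm b)\<^sup>2 - L' * (norm b)\<^sup>2"
      unfolding \<eta>(2) by (simp add: algebra_simps)
    ultimately show "L' * (norm b)\<^sup>2 + u (H a)
        \<le> 1 / (2 * pi) * integral {0..2 * pi} (\<lambda>\<theta>. u (H (a + ?e \<theta> *s b)))"
      using compare unfolding Q_def by linarith
  qed
qed

lemma usc_on_continuous:
  fixes f :: "'a::topological_space \<Rightarrow> real"
  assumes "continuous_on V f"
  shows "usc_on V (\<lambda>z. ereal (f z))"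
  unfolding usc_on_def
proof
  fix c
  have "continuous_on V (\<lambda>z. ereal (f z))"
    using assms by (intro continuous_intros)
  from continuous_openin_preimage_gen[OF this open_lessThan[of c]]
  show "openin (top_of_set V) {z \<in> V. ereal (f z) < c}"
    by (simp add: vimage_def Int_def)
qed

lemma uniformly_psh_pullback:
  fixes H :: "complex ^ 'n \<Rightarrow> complex ^ 'm" and u :: "complex ^ 'm \<Rightarrow> real"
  assumes H: "holomorphic_map_on H V'" and "open V'" "open V" "H ` V' \<subseteq> V"
    and psh: "uniformly_psh_on_average L V (\<lambda>z. ereal (u z))"
    and u: "C1_with_gradient V u G"
    and low: "c \<ge> 0" "\<And>w b. w \<in> V' \<Longrightarrow> c * norm b \<le> norm (frechet_derivative H (at w) b)"
    and L': "0 < L'" "L' < L * c\<^sup>2"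
  shows "uniformly_psh_on_average L' V' (\<lambda>w. ereal (u (H w)))"
proof -
  let ?e = "\<lambda>\<theta>. exp (\<i> * complex_of_real \<theta>)"
  define good where "good a s \<longleftrightarrow> (\<forall>b. norm b = s \<longrightarrow>
      (\<forall>\<zeta>\<in>cball 0 1. a + \<zeta> *s b \<in> V') \<and>
      L' * (norm b)\<^sup>2 + u (H a) \<le> 1 / (2 * pi) * integral {0..2 * pi} (\<lambda>\<theta>. u (H (a + ?e \<theta> *s b))))"
    for a s
  have cont: "continuous_on V' (\<lambda>w. u (H w))"
  proof (rule continuous_on_compose2[of V u V' H])
    show "continuous_on V u"
      using u by (auto simp: C1_with_gradient_def gderiv_def
          intro!: continuous_at_imp_continuous_on has_derivative_continuous)
    show "continuous_on V' H" by (rule holomorphic_map_continuous[OF H])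
  qed (use \<open>H ` V' \<subseteq> V\<close> in auto)
  have "\<exists>d>0. \<exists>N. open N \<and> a0 \<in> N \<and> (\<forall>a\<in>N. \<forall>s<d. good a s)" if a0: "a0 \<in> V'" for a0
  proof -
    obtain d where d: "d > 0" "ball a0 (2 * d) \<subseteq> V'"
      and ineq: "\<And>a b. \<lbrakk>a \<in> ball a0 d; norm b < d\<rbrakk> \<Longrightarrow>
         L' * (norm b)\<^sup>2 + u (H a) \<le>
           1 / (2 * pi) * integral {0..2 * pi} (\<lambda>\<theta>. u (H (a + ?e \<theta> *s b)))"
      using uniformly_psh_pullback_locally[OF H \<open>open V'\<close> \<open>open V\<close> \<open>H ` V' \<subseteq> V\<close> psh u low L'(2) a0]
      by metis
    have "a + \<zeta> *s b \<in> V'" if "a \<in> ball a0 d" "norm b < d" "\<zeta> \<in> cball 0 1" for a b \<zeta>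
    proof -
      have "norm (\<zeta> *s b) < d"
        using that mult_right_mono[of "norm \<zeta>" 1 "norm b"] by (simp add: norm_vector_scalar_mult)
      then have "a + \<zeta> *s b \<in> ball a0 (2 * d)"
        using that(1) norm_triangle_ineq[of "a - a0" "\<zeta> *s b"]
        by (simp add: dist_norm norm_minus_commute[of a0] algebra_simps)
      then show ?thesis using d(2) by blast
    qed
    then have "\<forall>a\<in>ball a0 d. \<forall>s<d. good a s"
      using ineq by (auto simp: good_def)
    then show ?thesis using d(1) by (intro exI[of _ d] conjI exI[of _ "ball a0 d"]) auto
  qed
  then obtain \<delta> where \<delta>: "lsc_on V' \<delta>" "\<And>a. a \<in> V' \<Longrightarrow> 0 < \<delta> a"
      "\<And>a s. \<lbrakk>a \<in> V'; s < \<delta> a\<rbrakk> \<Longrightarrow> good a s"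
    using locally_uniform_radius_lsc[of V' good] by metis
  have "(\<forall>\<zeta>\<in>cball 0 1. a + \<zeta> *s b \<in> V') \<and>
      ereal (L' * (norm b)\<^sup>2) + ereal (u (H a)) \<le> circle_mean (\<lambda>\<theta>. ereal (u (H (a + ?e \<theta> *s b))))"
    if "a \<in> V'" "norm b < \<delta> a" for a b
  proof -
    have disc: "\<forall>\<zeta>\<in>cball 0 1. a + \<zeta> *s b \<in> V'"
      and ineq: "L' * (norm b)\<^sup>2 + u (H a) \<le> 1 / (2 * pi) * integral {0..2 * pi} (\<lambda>\<theta>. u (H (a + ?e \<theta> *s b)))"
      using \<delta>(3)[OF that] by (auto simp: good_def)
    have "continuous_on {0..2 * pi} (\<lambda>\<theta>. a + ?e \<theta> *s b)"
      unfolding vector_scalar_mult_def by (intro continuous_intros)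
    then have "continuous_on {0..2 * pi} (\<lambda>\<theta>. u (H (a + ?e \<theta> *s b)))"
      using disc by (intro continuous_on_compose2[OF cont]) auto
    then show ?thesis
      using disc ineq by (simp add: circle_mean_ereal)
  qed
  note circle = this
  show ?thesis
    unfolding uniformly_psh_on_average_def
  proof (intro conjI exI[of _ \<delta>])
    show "\<forall>a\<in>V'. \<forall>b. norm b < \<delta> a \<longrightarrow>
          (\<forall>\<zeta>\<in>cball 0 1. a + \<zeta> *s b \<in> V') \<and>
          ereal (L' * (norm b)\<^sup>2) + ereal (u (H a)) \<le> circle_mean (\<lambda>\<theta>. ereal (u (H (a + ?e \<theta> *s b))))"
      using circle by blast
    show "usc_on V' (\<lambda>w. ereal (u (H w)))" by (rule usc_on_continuous[OF cont])
    show "lsc_on V' \<delta>" by (rule \<delta>(1))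
    show "\<forall>z\<in>V'. 0 < \<delta> z" using \<delta>(2) by blast
  qed (use L'(1) \<open>open V'\<close> in simp_all)
qed

section \<open>Pulling back gradients\<close>

text \<open>
  The adjoint of the derivative of \<open>H\<close> at \<open>w\<close>, applied to the vector \<open>G (H w)\<close>. It is written out in
  the real orthonormal basis so that its continuity in \<open>w\<close> follows from the continuity of each
  directional derivative of \<open>H\<close>.
\<close>

definition pullback_gradient ::
    "(complex ^ 'n \<Rightarrow> complex ^ 'm) \<Rightarrow> (complex ^ 'm \<Rightarrow> complex ^ 'm) \<Rightarrow> complex ^ 'n \<Rightarrow> complex ^ 'n" where
  "pullback_gradient H G w = (\<Sum>i\<in>Basis. (frechet_derivative H (at w) i \<bullet> G (H w)) *\<^sub>R i)"

lemma inner_pullback_gradient: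
  assumes "holomorphic_map_on H V'" "w \<in> V'"
  shows "h \<bullet> pullback_gradient H G w = frechet_derivative H (at w) h \<bullet> G (H w)"
proof -
  let ?D = "frechet_derivative H (at w)"
  have lin: "linear ?D"
    using assms by (intro has_derivative_linear[OF holomorphic_map_has_derivative])
  have "?D h = ?D (\<Sum>i\<in>Basis. (h \<bullet> i) *\<^sub>R i)"
    by (simp only: euclidean_representation)
  also have "\<dots> = (\<Sum>i\<in>Basis. (h \<bullet> i) *\<^sub>R ?D i)"
    by (simp only: linear_sum[OF lin] linear_scale[OF lin])
  finally show ?thesis
    by (simp add: pullback_gradient_def inner_sum_right inner_sum_left mult.commute)
qed

lemma C1_pullback:
  assumes H: "holomorphic_map_on H V'" and "open V'" "H ` V' \<subseteq> V" and u: "C1_with_gradient V u G"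
  shows "C1_with_gradient V' (\<lambda>w. u (H w)) (pullback_gradient H G)"
  unfolding C1_with_gradient_def
proof (intro conjI ballI)
  fix w assume w: "w \<in> V'"
  then have "(u has_derivative (\<lambda>h. h \<bullet> G (H w))) (at (H w))"
    using u \<open>H ` V' \<subseteq> V\<close> by (auto simp: C1_with_gradient_def gderiv_def)
  from has_derivative_compose[OF holomorphic_map_has_derivative[OF H w] this]
  show "GDERIV (\<lambda>w. u (H w)) w :> pullback_gradient H G w"
    by (simp add: gderiv_def inner_pullback_gradient[OF H w])
next
  have "continuous_on V' (\<lambda>w. G (H w))"
    using u \<open>H ` V' \<subseteq> V\<close> unfolding C1_with_gradient_def
    by (auto intro: continuous_on_compose2[OF _ holomorphic_map_continuous[OF H]])
  then show "continuous_on V' (pullback_gradient H G)"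
    unfolding pullback_gradient_def
    by (intro continuous_intros holomorphic_map_derivative_continuous[OF H \<open>open V'\<close>])
qed

lemma norm_pullback_gradient_le:
  assumes H: "holomorphic_map_on H V'" "w \<in> V'"
    and B: "B \<ge> 0" "\<And>b. norm (frechet_derivative H (at w) b) \<le> B * norm b"
  shows "norm (pullback_gradient H G w) \<le> B * norm (G (H w))"
proof (cases "pullback_gradient H G w = 0")
  case True
  then show ?thesis using B(1) by simp
next
  case False
  let ?g = "pullback_gradient H G w"
  have "norm ?g * norm ?g = frechet_derivative H (at w) ?g \<bullet> G (H w)"
    using inner_pullback_gradient[OF H, of ?g G] by (simp add: power2_norm_eq_inner flip: power2_eq_square)
  also have "\<dots> \<le> (B * norm ?g) * norm (G (H w))"
    using norm_cauchy_schwarz B(2)[of ?g] by (meson mult_right_mono norm_ge_zero order_trans)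
  finally show ?thesis using False by (simp add: mult.assoc mult.commute mult.left_commute)
qed

text \<open>
  The lower bound comes from pairing the pulled-back gradient with a direction \<open>h\<close> of controlled
  length that the derivative of \<open>H\<close> maps to the gradient itself. For an invertible \<open>H\<close> such an \<open>h\<close> is
  supplied by the derivative of the inverse.
\<close>

lemma norm_pullback_gradient_ge:
  assumes H: "holomorphic_map_on H V'" "w \<in> V'"
    and h: "frechet_derivative H (at w) h = G (H w)" "norm h \<le> B * norm (G (H w))"
  shows "norm (G (H w)) \<le> B * norm (pullback_gradient H G w)"
proof (cases "G (H w) = 0")
  case True
  let ?g = "pullback_gradient H G w"
  have "?g \<bullet> ?g = 0"
    using inner_pullback_gradient[OF H, of ?g G] True by simp
  then show ?thesis using True by simp
next
  case False
  let ?g = "pullback_gradient H G w"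
  have "norm (G (H w)) * norm (G (H w)) = h \<bullet> ?g"
    using inner_pullback_gradient[OF H, of h G] h(1)
    by (simp add: power2_norm_eq_inner flip: power2_eq_square)
  also have "\<dots> \<le> (B * norm (G (H w))) * norm ?g"
    using norm_cauchy_schwarz h(2) by (meson mult_right_mono norm_ge_zero order_trans)
  finally show ?thesis using False by (simp add: mult.assoc mult.commute mult.left_commute)
qed

section \<open>Biholomorphic invariance\<close>

lemma derivative_of_right_inverse:
  assumes F: "holomorphic_map_on F W" and H: "holomorphic_map_on H W'" and "open W'"
    and inv: "\<And>w. w \<in> W' \<Longrightarrow> H w \<in> W \<and> F (H w) = w" and w: "w \<in> W'"
  shows "frechet_derivative F (at (H w)) (frechet_derivative H (at w) b) = b"
proof -
  have "((\<lambda>w. F (H w)) has_derivative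
          (\<lambda>b. frechet_derivative F (at (H w)) (frechet_derivative H (at w) b))) (at w)"
    using inv[OF w] by (blast intro: has_derivative_compose[OF holomorphic_map_has_derivative[OF H w]
          holomorphic_map_has_derivative[OF F]])
  then have "((\<lambda>w. w) has_derivative
          (\<lambda>b. frechet_derivative F (at (H w)) (frechet_derivative H (at w) b))) (at w)"
    by (rule has_derivative_transform_within_open[OF _ \<open>open W'\<close> w]) (use inv in auto)
  from fun_cong[OF has_derivative_unique[OF this has_derivative_ident], of b] show ?thesis
    by simp
qed

lemma compact_neighbourhood_within_open:
  fixes K :: "'a::heine_borel set"
  assumes "compact K" "open A" "K \<subseteq> A"
  obtains N where "open N" "K \<subseteq> N" "compact (closure N)" "closure N \<subseteq> A"
proof -
  have "\<exists>N C. K \<subseteq> N \<and> N \<subseteq> C \<and> C \<subseteq> A \<and> openin (top_of_set A) N \<and> compact C"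
    using iffD1[OF locally_compact_compact open_imp_locally_compact[OF \<open>open A\<close>], THEN spec, of K]
      assms(1,3) by simp
  then obtain N C where N: "K \<subseteq> N" "N \<subseteq> C" "C \<subseteq> A" "openin (top_of_set A) N" "compact C"
    by auto
  have "open N" using N(4) \<open>open A\<close> by (simp add: openin_open_eq)
  moreover have "closure N \<subseteq> C" using N(2,5) by (simp add: closure_minimal compact_imp_closed)
  moreover have "compact (closure N)"
    using N(2,5) by (meson bounded_subset compact_closure compact_imp_bounded)
  ultimately show ?thesis using N that by blast
qed

lemma holomorphic_map_on_subset:
  "holomorphic_map_on F W \<Longrightarrow> S \<subseteq> W \<Longrightarrow> holomorphic_map_on F S"
  unfolding holomorphic_map_on_def by blast

lemma biholomorphic_image_open:
  assumes F: "biholomorphic_map F W W'" and "open S" "S \<subseteq> W"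
  shows "open (F ` S)"
proof -
  let ?H = "inv_into W F"
  have bij: "bij_betw F W W'" and "open W'" and H: "holomorphic_map_on ?H W'"
    using F unfolding biholomorphic_map_def by blast+
  have "F ` S = ?H -` S \<inter> W'"
  proof (intro equalityI subsetI)
    fix w assume "w \<in> F ` S"
    then show "w \<in> ?H -` S \<inter> W'"
      using bij \<open>S \<subseteq> W\<close> by (auto simp: bij_betw_def subset_eq)
  next
    fix w assume w: "w \<in> ?H -` S \<inter> W'"
    then have "w = F (?H w)" using bij by (auto simp: bij_betw_def f_inv_into_f)
    then show "w \<in> F ` S" using w by (metis IntD1 imageI vimageD)
  qed
  then show ?thesis
    using continuous_open_preimage[OF holomorphic_map_continuous[OF H] \<open>open W'\<close> \<open>open S\<close>]
    by (simp add: Int_commute)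
qed

lemma closure_continuous_image_subset:
  fixes F :: "'a::topological_space \<Rightarrow> 'b::t2_space"
  assumes "continuous_on W F" "compact (closure S)" "closure S \<subseteq> W"
  shows "compact (F ` closure S)" "closure (F ` S) \<subseteq> F ` closure S"
proof -
  show c: "compact (F ` closure S)"
    using assms by (meson compact_continuous_image continuous_on_subset)
  show "closure (F ` S) \<subseteq> F ` closure S"
    using c by (intro closure_minimal image_mono closure_subset compact_imp_closed)
qed

theorem proposition3p22:
  fixes U W W' :: "(complex ^ 'n) set" and F :: "complex ^ 'n \<Rightarrow> complex ^ 'n"
  assumes "zero_uniformly_pseudoconvex U"
    and "biholomorphic_map F W W'"
    and "closure U \<subseteq> W"
  shows "zero_uniformly_pseudoconvex (F ` U)"
proof -
  define H where "H = inv_into W F"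
  have "open W" "open W'" and bij: "bij_betw F W W'"
    and F: "holomorphic_map_on F W" and H: "holomorphic_map_on H W'"
    using assms(2) unfolding biholomorphic_map_def H_def by blast+
  have HF: "H (F z) = z" if "z \<in> W" for z
    using bij that by (simp add: H_def bij_betw_def)
  have HW: "H w \<in> W \<and> F (H w) = w" if "w \<in> W'" for w
    using bij that unfolding H_def bij_betw_def by (metis f_inv_into_f inv_into_into)
  have FW: "F z \<in> W'" if "z \<in> W" for z
    using bij that by (auto simp: bij_betw_def)
  have contF: "continuous_on W F" by (rule holomorphic_map_continuous[OF F])
  have DFDH: "frechet_derivative F (at (H w)) (frechet_derivative H (at w) b) = b" if "w \<in> W'" for w b
    by (rule derivative_of_right_inverse[OF F H \<open>open W'\<close> HW that])
  have DHDF: "frechet_derivative H (at w) (frechet_derivative F (at (H w)) b) = b" if "w \<in> W'" for w b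
    using derivative_of_right_inverse[OF H F \<open>open W\<close>, of "H w" b] HF FW HW[OF that] by auto

  have U: "open U" "connected U" "U \<noteq> {}" "compact (closure U)"
    using assms(1) unfolding zero_uniformly_pseudoconvex_def by auto
  obtain L M M' V1 V2 r and R :: "nat \<Rightarrow> complex ^ 'n \<Rightarrow> real" and G where
    Gbd: "\<forall>m. \<forall>z\<in>closure V1. M \<le> norm (G m z) \<and> norm (G m z) \<le> M'"
    and psh: "\<forall>m. uniformly_psh_on_average L V2 (\<lambda>z. ereal (R m z))"
    and lim: "\<forall>z\<in>V2. (\<lambda>m. R m z) \<longlonglongrightarrow> r z"
    and bdd: "\<forall>z\<in>V2. bounded (range (\<lambda>m. R m z))"
    and G: "\<forall>m. C1_with_gradient V2 (R m) (G m)"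
    and r: "U \<inter> V2 = {z \<in> V2. r z < 0}"
    and pos: "L > 0" "M > 0" "M' > 0"
    and V1: "open V1" "frontier U \<subseteq> V1" and V2: "open V2" "closure V1 \<subseteq> V2"
    using assms(1) unfolding zero_uniformly_pseudoconvex_def
    by (elim conjE exE) (rule that, assumption+)

  have "U \<subseteq> W" using assms(3) closure_subset by blast
  have frU: "frontier U \<subseteq> W" "compact (frontier U)"
    using assms(3) U(4) by (auto simp: frontier_def compact_diff)
  \<comment> \<open>Shrinking the given neighbourhoods into \<open>W\<close> gives them compact closures there, on which the
    derivatives of \<open>F\<close> and of \<open>H\<close> are bounded.\<close>
  obtain N1 where N1: "open N1" "frontier U \<subseteq> N1" "compact (closure N1)" "closure N1 \<subseteq> W \<inter> V1"
    using compact_neighbourhood_within_open[OF frU(2), of "W \<inter> V1"] \<open>open W\<close> V1 frU(1) by auto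
  have "closure N1 \<subseteq> W \<inter> V2" using N1(4) V2(2) closure_subset by blast
  then obtain N2 where N2: "open N2" "closure N1 \<subseteq> N2" "compact (closure N2)" "closure N2 \<subseteq> W \<inter> V2"
    using compact_neighbourhood_within_open[OF N1(3), of "W \<inter> V2"] \<open>open W\<close> V2(1) by auto
  have N2W: "closure N2 \<subseteq> W" "N2 \<subseteq> W" "N2 \<subseteq> V2" using N2(4) closure_subset[of N2] by auto
  have N1W: "closure N1 \<subseteq> W" "N1 \<subseteq> W" using N1(4) closure_subset[of N1] by auto
  note cl1 = closure_continuous_image_subset[OF contF N1(3) N1W(1)]
  note cl2 = closure_continuous_image_subset[OF contF N2(3) N2W(1)]
  note clU = closure_continuous_image_subset[OF contF U(4) assms(3)]
  have FN2: "F ` N2 \<subseteq> W'" "H ` (F ` N2) \<subseteq> N2"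
    using FW N2W HF by auto
  have HV2: "H ` (F ` N2) \<subseteq> V2" using FN2(2) N2W(3) by blast
  have openFU: "open (F ` U)" and openF1: "open (F ` N1)" and openF2: "open (F ` N2)"
    using biholomorphic_image_open[OF assms(2)] U(1) \<open>U \<subseteq> W\<close> N1(1) N1W(2) N2(1) N2W(2) by auto
  have HF2: "holomorphic_map_on H (F ` N2)"
    by (rule holomorphic_map_on_subset[OF H FN2(1)])

  obtain KF where KF: "KF > 0"
    "\<And>z b. z \<in> closure N2 \<Longrightarrow> norm (frechet_derivative F (at z) b) \<le> KF * norm b"
    using holomorphic_map_derivative_bounded[OF F \<open>open W\<close> N2(3) N2W(1)] by metis
  have "F ` closure N2 \<subseteq> W'" using FW N2W(1) by blast
  then obtain KH where KH: "KH > 0"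
    "\<And>w b. w \<in> F ` closure N2 \<Longrightarrow> norm (frechet_derivative H (at w) b) \<le> KH * norm b"
    using holomorphic_map_derivative_bounded[OF H \<open>open W'\<close> cl2(1)] by metis

  have low: "(1 / KF) * norm b \<le> norm (frechet_derivative H (at w) b)" if w: "w \<in> F ` N2" for w b
  proof -
    have "w \<in> W'" "H w \<in> closure N2" using w FN2 closure_subset[of N2] by auto
    then have "norm b \<le> KF * norm (frechet_derivative H (at w) b)"
      using KF(2)[of "H w" "frechet_derivative H (at w) b"] DFDH by simp
    then show ?thesis using KF(1) by (simp add: field_simps)
  qed
  \<comment> \<open>The factor 2 makes \<open>L'\<close> strictly smaller than \<open>L * c\<^sup>2\<close> with \<open>c = 1 / KF\<close>.\<close>
  define L' where "L' = L * (1 / KF)\<^sup>2 / 2"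
  have "L * (1 / KF)\<^sup>2 > 0" using pos(1) KF(1) by simp
  then have L': "0 < L'" "L' < L * (1 / KF)\<^sup>2" unfolding L'_def by linarith+

  have frontier: "frontier (F ` U) \<subseteq> F ` frontier U"
  proof -
    have "frontier (F ` U) = closure (F ` U) - F ` U"
      using openFU by (simp add: frontier_def interior_open)
    also have "\<dots> \<subseteq> F ` (closure U - U)" using clU(2) by auto
    also have "closure U - U = frontier U" using U(1) by (simp add: frontier_def interior_open)
    finally show ?thesis .
  qed

  have gradient: "M / KF \<le> norm (pullback_gradient H (G m) w) \<and>
                  norm (pullback_gradient H (G m) w) \<le> KH * M'"
    if w0: "w \<in> closure (F ` N1)" for m w
  proof -
    obtain z where z: "z \<in> closure N1" "w = F z" using subsetD[OF cl1(2) w0] by blast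
    have Hw: "H w = z" using z N1W(1) HF by auto
    have zN: "z \<in> N2" "z \<in> closure N2" using z(1) N2(2) closure_subset[of N2] by auto
    have w: "w \<in> W'" "w \<in> F ` N2" "w \<in> F ` closure N2" using z zN N1W(1) FW by auto
    have "z \<in> closure V1" using z(1) N1(4) closure_subset by blast
    then have Gz: "M \<le> norm (G m z)" "norm (G m z) \<le> M'" using Gbd by auto
    have "norm (pullback_gradient H (G m) w) \<le> KH * norm (G m (H w))"
      using KH(1) by (intro norm_pullback_gradient_le[OF H w(1) _ KH(2)[OF w(3)]]) simp
    also have "\<dots> \<le> KH * M'" using Gz(2) KH(1) by (simp add: Hw)
    finally have upper: "norm (pullback_gradient H (G m) w) \<le> KH * M'" .
    have "norm (G m (H w)) \<le> KF * norm (pullback_gradient H (G m) w)"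
      using DHDF[OF w(1), of "G m (H w)"] KF(2)[OF zN(2), of "G m z"]
      by (intro norm_pullback_gradient_ge[OF H w(1), where h = "frechet_derivative F (at z) (G m z)"])
         (simp_all add: Hw)
    then have "M \<le> KF * norm (pullback_gradient H (G m) w)" using Gz(1) by (simp add: Hw)
    then show ?thesis using upper KF(1) by (simp add: field_simps)
  qed

  have sub: "F ` U \<inter> F ` N2 = {w \<in> F ` N2. r (H w) < 0}"
  proof -
    have iff: "F z \<in> F ` U \<longleftrightarrow> r (H (F z)) < 0" if "z \<in> N2" for z
    proof -
      have "F z \<in> F ` U \<longleftrightarrow> z \<in> U"
        using bij \<open>U \<subseteq> W\<close> N2W(2) that
        by (intro inj_on_image_mem_iff[where B = W]) (auto simp: bij_betw_def)
      moreover have "z \<in> U \<longleftrightarrow> r z < 0" using r N2W(3) that by blast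
      moreover have "H (F z) = z" using HF N2W(2) that by blast
      ultimately show ?thesis by (simp only:)
    qed
    have "w \<in> F ` U \<longleftrightarrow> r (H w) < 0" if "w \<in> F ` N2" for w
      using that iff by (elim imageE) (simp only:)
    then show ?thesis by blast
  qed

  have topU: "connected (F ` U)" "F ` U \<noteq> {}" "compact (closure (F ` U))"
  proof -
    show "connected (F ` U)"
      using continuous_on_subset[OF contF \<open>U \<subseteq> W\<close>] U(2) by (rule connected_continuous_image)
    show "F ` U \<noteq> {}" using U(3) by simp
    show "compact (closure (F ` U))"
      using clU by (metis closed_closure compact_Int_closed inf.absorb_iff2)
  qed
  have bounded: "bounded (F ` N1)" "bounded (F ` N2)"
    using bounded_subset[OF compact_imp_bounded[OF cl1(1)] image_mono[OF closure_subset]]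
      bounded_subset[OF compact_imp_bounded[OF cl2(1)] image_mono[OF closure_subset]] by auto
  have cover: "frontier (F ` U) \<subseteq> F ` N1" "frontier (F ` U) \<subseteq> F ` N2" "closure (F ` N1) \<subseteq> F ` N2"
    using frontier N1(2) cl1(2) N2(2) closure_subset[of N1] by blast+
  have grad_bounds_pos: "0 < M / KF" "0 < KH * M'"
    using pos KF(1) KH(1) by simp_all
  have psh': "uniformly_psh_on_average L' (F ` N2) (\<lambda>w. ereal (R m (H w)))" for m
    by (rule uniformly_psh_pullback[OF HF2 openF2 V2(1) HV2 psh[rule_format] G[rule_format] _ low L'])
       (use KF(1) in auto)
  have C1': "C1_with_gradient (F ` N2) (\<lambda>w. R m (H w)) (pullback_gradient H (G m))" for m
    by (rule C1_pullback[OF HF2 openF2 HV2 G[rule_format]])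
  have R': "bounded (range (\<lambda>m. R m (H w)))" "(\<lambda>m. R m (H w)) \<longlonglongrightarrow> r (H w)" if "w \<in> F ` N2" for w
    using HV2 that bdd lim by blast+
  have approx: "\<exists>R' G'. (\<forall>w\<in>F ` N2. bounded (range (\<lambda>m. R' m w))) \<and>
       (\<forall>w\<in>F ` N2. (\<lambda>m. R' m w) \<longlonglongrightarrow> r (H w)) \<and>
       (\<forall>m::nat. C1_with_gradient (F ` N2) (R' m) (G' m)) \<and>
       (\<forall>m. uniformly_psh_on_average L' (F ` N2) (\<lambda>w. ereal (R' m w))) \<and>
       (\<forall>m. \<forall>w\<in>closure (F ` N1). M / KF \<le> norm (G' m w) \<and> norm (G' m w) \<le> KH * M')"
    by (rule exI[of _ "\<lambda>m w. R m (H w)"], rule exI[of _ "\<lambda>m. pullback_gradient H (G m)"])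
       (use R' psh' C1' gradient in simp)
  show ?thesis
    unfolding zero_uniformly_pseudoconvex_def
    by (rule conjI[OF openFU], rule conjI[OF topU(1)], rule conjI[OF topU(2)], rule conjI[OF topU(3)],
        rule exI[of _ L'], rule exI[of _ "M / KF"], rule exI[of _ "KH * M'"],
        rule conjI[OF L'(1)], rule conjI[OF grad_bounds_pos(1)], rule conjI[OF grad_bounds_pos(2)],
        rule exI[of _ "F ` N1"], rule exI[of _ "F ` N2"],
        rule conjI[OF openF1], rule conjI[OF bounded(1)], rule conjI[OF cover(1)],
        rule conjI[OF openF2], rule conjI[OF bounded(2)], rule conjI[OF cover(2)],
        rule conjI[OF cover(3)], rule exI[of _ "\<lambda>w. r (H w)"], rule conjI[OF sub], rule approx)
qed

end
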